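(* Assume that the function $\lambda\in\mathbb{R}\mapsto m(\lambda)$ is strictly decreasing. Let $c>0$ be fixed and assume that there exists a minimizing sequence $(u_n)\subset H$ for $m(c)$ (i.e. $G(u_n)=c$ for all $n$ and $J(u_n)\to m(c)$) such that: (a) $(u_n)$ is bounded in $H$; (b) if (up to a subsequence) $u_n\rightharpoonup u$ weakly in $H$, then $J(u)\le \liminf_{n\to\infty}J(u_n)$ (liminf along that subsequence) and $G(u)\le c$. Then $m(c)$ is reached, i.e. there exists $w\in H$ with $G(w)=c$ and $J(w)=m(c)$.
   Context: Let $N,m\ge 1$, let $H$ be a reflexive Banach space of functions on $\mathbb{R}^N$ with values in $\mathbb{R}^m$, and let $J,G$ be (real-valued) functionals defined on $H$ of the form $$J(u)=\int_{\mathbb{R}^N} j(x,u,|\nabla u|)\,dx,\qquad G(u)=\int_{\mathbb{R}^N} g(u)\,dx,$$ where $j(x,s,t)$ and $g(s)$ are real-valued functions defined on $\mathbb{R}^N\times\mathbb{R}^m\times\mathbb{R}$ and $\mathbb{R}^m$ respectively. For $c\in\mathbb{R}$ set $$m(c)=\inf\{J(u):\ u\in H,\ G(u)=c\}.$$ *)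

theory Defs
  imports "HOL-Analysis.Analysis"
begin

section \<open>Reflexivity and weak convergence\<close>

text \<open>The canonical embedding into the bidual is onto.\<close>

definition reflexive_space :: "'h::real_normed_vector itself \<Rightarrow> bool" where
  "reflexive_space _ \<longleftrightarrow>
     (\<forall>\<Phi> :: ('h \<Rightarrow>\<^sub>L real) \<Rightarrow>\<^sub>L real. \<exists>u::'h. \<forall>f. blinfun_apply \<Phi> f = blinfun_apply f u)"

definition weakly_converges :: "(nat \<Rightarrow> 'h::real_normed_vector) \<Rightarrow> 'h \<Rightarrow> bool" where
  "weakly_converges X u \<longleftrightarrow>
     (\<forall>f :: 'h \<Rightarrow>\<^sub>L real. (\<lambda>n. blinfun_apply f (X n)) \<longlonglongrightarrow> blinfun_apply f u)"

section \<open>Weak gradients\<close>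

definition partial_deriv :: "'n \<Rightarrow> (real^'n::finite \<Rightarrow> real) \<Rightarrow> real^'n \<Rightarrow> real" where
  "partial_deriv i f x = frechet_derivative f (at x) (axis i 1)"

text \<open>
  Demanding total differentiability loses nothing: it follows from continuity of the partial
  derivatives.
\<close>

primrec C_k :: "nat \<Rightarrow> (real^'n::finite \<Rightarrow> real) \<Rightarrow> bool" where
  "C_k 0 f \<longleftrightarrow> continuous_on UNIV f"
| "C_k (Suc k) f \<longleftrightarrow> (\<forall>x. f differentiable (at x)) \<and> (\<forall>i. C_k k (partial_deriv i f))"

definition test_function :: "(real^'n::finite \<Rightarrow> real) \<Rightarrow> bool" where
  "test_function \<phi> \<longleftrightarrow> (\<forall>k. C_k k \<phi>) \<and> compact (closure {x. \<phi> x \<noteq> 0})"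

definition locally_integrable :: "(real^'n::finite \<Rightarrow> 'b::{banach, second_countable_topology}) \<Rightarrow> bool" where
  "locally_integrable f \<longleftrightarrow> (\<forall>K. compact K \<longrightarrow> set_integrable lebesgue K f)"

text \<open>
  Row \<open>a\<close>, column \<open>i\<close> of \<open>D x\<close> is the \<open>i\<close>-th partial derivative of the \<open>a\<close>-th component
  of \<open>v\<close>. The norm on \<open>real^'N^'m\<close> is the Euclidean (Frobenius) norm of the matrix.
\<close>

definition has_weak_gradient ::
    "(real^'N::finite \<Rightarrow> real^'m::finite) \<Rightarrow> (real^'N \<Rightarrow> real^'N^'m) \<Rightarrow> bool" where
  "has_weak_gradient v D \<longleftrightarrow> locally_integrable v \<and> locally_integrable D \<and>
     (\<forall>\<phi> a i. test_function \<phi> \<longrightarrow>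
        (LINT x|lebesgue. v x $ a * partial_deriv i \<phi> x) = - (LINT x|lebesgue. D x $ a $ i * \<phi> x))"

text \<open>
  The weak gradient is unique up to a null set, so the choice does not affect integrals.
\<close>

definition weak_gradient ::
    "(real^'N::finite \<Rightarrow> real^'m::finite) \<Rightarrow> (real^'N \<Rightarrow> real^'N^'m)" where
  "weak_gradient v = (SOME D. has_weak_gradient v D)"

section \<open>Banach spaces of functions\<close>

text \<open>
  As usual for Lebesgue and Sobolev spaces, functions are identified when they agree almost
  everywhere. The Banach space is a type \<open>'h\<close>, and \<open>rep u\<close> is a representative of the element
  \<open>u\<close>: taking classes, \<open>rep\<close> becomes an injective linear map from \<open>'h\<close> into the measurable
  functions modulo null sets. No relation between the norm and \<open>rep\<close> is imposed.
\<close>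

definition function_space_rep ::
    "('h::banach \<Rightarrow> real^'N::finite \<Rightarrow> real^'m::finite) \<Rightarrow> bool" where
  "function_space_rep rep \<longleftrightarrow>
     (\<forall>u. rep u \<in> borel_measurable lebesgue) \<and>
     (\<forall>u v. AE x in lebesgue. rep (u + v) x = rep u x + rep v x) \<and>
     (\<forall>a u. AE x in lebesgue. rep (a *\<^sub>R u) x = a *\<^sub>R rep u x) \<and>
     (\<forall>u. (AE x in lebesgue. rep u x = 0) \<longrightarrow> u = 0)"

section \<open>The constrained infimum\<close>

text \<open>
  Taken in the extended reals: \<open>\<infinity>\<close> for an empty constraint set, possibly \<open>-\<infinity>\<close> if \<open>J\<close> is
  unbounded below.
\<close>

definition constrained_inf :: "('h \<Rightarrow> real) \<Rightarrow> ('h \<Rightarrow> real) \<Rightarrow> real \<Rightarrow> ereal" where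
  "constrained_inf J G c = (INF u\<in>{u. G u = c}. ereal (J u))"

end

theory Submission
  imports Defs "HOL-Complex_Analysis.Great_Picard"
begin

text \<open>
  The minimizing sequence is bounded in a reflexive space, so a subsequence converges weakly to
  some \<open>u\<close>. Lower semicontinuity gives \<open>J u \<le> m(c)\<close>, and \<open>G u \<le> c\<close>. If \<open>G u\<close> were smaller than \<open>c\<close>,
  strict monotonicity would give \<open>m(c) < m(G u) \<le> J u \<le> m(c)\<close>; hence \<open>G u = c\<close> and \<open>u\<close> is a
  minimizer.

  Most of the work goes into the weak sequential compactness of bounded sequences
  (\<open>reflexive_bounded_imp_weakly_convergent_subsequence\<close>). Weak cluster points come from
  reflexivity: the upper limit of \<open>f (v n)\<close>, as a function of \<open>f\<close>, is a bounded sublinear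
  functional on the dual space. A linear functional below it, given by Hahn-Banach, is evaluation
  at some point \<open>u\<close>, with \<open>f u\<close> between the lower and the upper limit of \<open>f (v n)\<close> for every \<open>f\<close>
  (\<open>ex_generalized_weak_limit\<close>). Such points lie in the closed span of the sequence, which is
  separable, so countably many functionals separate its points. Along a diagonal subsequence each
  of these functionals converges, so there is only one such point. As Hahn-Banach lets \<open>f u\<close> equal
  the upper limit of \<open>f (v n)\<close> for any one prescribed \<open>f\<close>, that unique point is the weak limit.

  The Hahn-Banach theorem is derived from Zorn's lemma on sublinear functionals rather than on
  partial linear functionals: a minimal sublinear functional is linear.
\<close>

section \<open>Sublinear functionals and the Hahn-Banach theorem\<close>

definition sublinear :: "('a::real_vector \<Rightarrow> real) \<Rightarrow> bool" where
  "sublinear p \<longleftrightarrow> (\<forall>x y. p (x + y) \<le> p x + p y) \<and> (\<forall>a>0. \<forall>x. p (a *\<^sub>R x) \<le> a * p x)"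

lemma sublinearI:
  assumes "\<And>x y. p (x + y) \<le> p x + p y" "\<And>a x. a > 0 \<Longrightarrow> p (a *\<^sub>R x) \<le> a * p x"
  shows "sublinear p"
  using assms by (auto simp: sublinear_def)

lemma sublinear_add: "sublinear p \<Longrightarrow> p (x + y) \<le> p x + p y"
  by (simp add: sublinear_def)

lemma sublinear_scaleR_pos:
  assumes "sublinear p" "a > 0"
  shows "p (a *\<^sub>R x) = a * p x"
proof (rule antisym)
  show "p (a *\<^sub>R x) \<le> a * p x" using assms by (simp add: sublinear_def)
  have "p (inverse a *\<^sub>R (a *\<^sub>R x)) \<le> inverse a * p (a *\<^sub>R x)"
    using assms unfolding sublinear_def by (metis inverse_positive_iff_positive)
  then show "a * p x \<le> p (a *\<^sub>R x)"
    using assms(2) by (simp add: field_simps)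
qed

lemma sublinear_zero: "sublinear p \<Longrightarrow> p 0 = 0"
  using sublinear_scaleR_pos[of p 2 0] by simp

lemma sublinear_scaleR_nonneg: "sublinear p \<Longrightarrow> a \<ge> 0 \<Longrightarrow> p (a *\<^sub>R x) = a * p x"
  by (cases "a = 0") (auto simp: sublinear_zero sublinear_scaleR_pos)

lemma sublinear_minus: "sublinear p \<Longrightarrow> - p (- x) \<le> p x"
  using sublinear_add[of p x "- x"] by (simp add: sublinear_zero)

text \<open>
  A sublinear \<open>p\<close> is linear once \<open>p (- y) = - p y\<close> for all \<open>y\<close>. The functional below is a
  sublinear minorant of \<open>p\<close> whose value at \<open>- y\<close> is at most \<open>- p y\<close>, so it lies strictly below \<open>p\<close>
  somewhere if the oddness fails at \<open>y\<close>.
\<close>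

definition lower_along :: "('a::real_vector \<Rightarrow> real) \<Rightarrow> 'a \<Rightarrow> 'a \<Rightarrow> real" where
  "lower_along p y x = (INF t\<in>{0..}. p (x + t *\<^sub>R y) - t * p y)"

lemma lower_along_le:
  assumes "sublinear p" "t \<ge> 0"
  shows "lower_along p y x \<le> p (x + t *\<^sub>R y) - t * p y"
  unfolding lower_along_def
proof (rule cINF_lower)
  have "- p (- x) \<le> p (x + s *\<^sub>R y) - s * p y" if "s \<ge> 0" for s
    using sublinear_add[OF assms(1), of "x + s *\<^sub>R y" "- x"]
      sublinear_scaleR_nonneg[OF assms(1) that, of y] by simp
  then show "bdd_below ((\<lambda>s. p (x + s *\<^sub>R y) - s * p y) ` {0..})"
    by (intro bdd_belowI2[of _ "- p (- x)"]) auto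
qed (use assms in auto)

lemma lower_along_greatest:
  "(\<And>t. t \<ge> 0 \<Longrightarrow> b \<le> p (x + t *\<^sub>R y) - t * p y) \<Longrightarrow> b \<le> lower_along p y x"
  unfolding lower_along_def by (rule cINF_greatest) auto

lemma lower_along_le_self: "sublinear p \<Longrightarrow> lower_along p y x \<le> p x"
  using lower_along_le[of p 0 y x] by simp

lemma lower_along_minus: "sublinear p \<Longrightarrow> lower_along p y (- y) \<le> - p y"
  using lower_along_le[of p 1 y "- y"] by (simp add: sublinear_zero)

text \<open>
  Given parameters \<open>s\<close> for \<open>x\<close> and \<open>t\<close> for \<open>x'\<close>, the parameter \<open>s + t\<close> serves for \<open>x + x'\<close>;
  multiplying \<open>x\<close> by \<open>a\<close> multiplies the parameter by \<open>a\<close>.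
\<close>

lemma sublinear_lower_along:
  assumes p: "sublinear p"
  shows "sublinear (lower_along p y)"
proof (rule sublinearI)
  fix x x'
  have "lower_along p y (x + x') - (p (x + s *\<^sub>R y) - s * p y) \<le> p (x' + t *\<^sub>R y) - t * p y"
    if "s \<ge> 0" "t \<ge> 0" for s t
    using lower_along_le[OF p, of "s + t" y "x + x'"] that
      sublinear_add[OF p, of "x + s *\<^sub>R y" "x' + t *\<^sub>R y"]
    by (simp add: algebra_simps)
  then have "lower_along p y (x + x') - (p (x + s *\<^sub>R y) - s * p y) \<le> lower_along p y x'"
    if "s \<ge> 0" for s
    using that by (intro lower_along_greatest) auto
  then have "lower_along p y (x + x') - lower_along p y x' \<le> lower_along p y x"
    by (intro lower_along_greatest) (simp add: algebra_simps)
  then show "lower_along p y (x + x') \<le> lower_along p y x + lower_along p y x'" by simp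
next
  fix a :: real and x assume a: "a > 0"
  have "lower_along p y (a *\<^sub>R x) / a \<le> lower_along p y x"
  proof (rule lower_along_greatest)
    fix t :: real assume "t \<ge> 0"
    then show "lower_along p y (a *\<^sub>R x) / a \<le> p (x + t *\<^sub>R y) - t * p y"
      using lower_along_le[OF p, of "a * t" y "a *\<^sub>R x"] a
        sublinear_scaleR_pos[OF p a, of "x + t *\<^sub>R y"]
      by (simp add: field_simps scaleR_add_right)
  qed
  then show "lower_along p y (a *\<^sub>R x) \<le> a * lower_along p y x"
    using a by (simp add: field_simps)
qed

text \<open>
  By minimality, \<open>p\<close> coincides with \<open>lower_along p y\<close> for each \<open>y\<close>. This makes \<open>p\<close> odd, and
  oddness turns the subadditivity inequality around.
\<close>

lemma minimal_sublinear_imp_linear: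
  assumes p: "sublinear p" and min: "\<And>q. sublinear q \<Longrightarrow> q \<le> p \<Longrightarrow> q = p"
  shows "linear p"
proof -
  have odd: "p (- y) = - p y" for y
  proof (rule antisym)
    have "lower_along p y = p"
      using min[OF sublinear_lower_along[OF p]] lower_along_le_self[OF p] by (simp add: le_fun_def)
    then show "p (- y) \<le> - p y"
      using lower_along_minus[OF p, of y] by simp
    show "- p y \<le> p (- y)"
      using sublinear_minus[OF p, of "- y"] by simp
  qed
  show ?thesis
  proof (rule linearI)
    show "p (x + y) = p x + p y" for x y
      using sublinear_add[OF p, of x y] sublinear_add[OF p, of "x + y" "- y"] odd[of y] by simp
    show "p (a *\<^sub>R x) = a *\<^sub>R p x" for a x
    proof (cases "a \<ge> 0")
      case True
      then show ?thesis by (simp add: sublinear_scaleR_nonneg[OF p])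
    next
      case False
      then show ?thesis
        using sublinear_scaleR_nonneg[OF p, of "- a" x] odd[of "a *\<^sub>R x"] by simp
    qed
  qed
qed

text \<open>
  The pointwise infimum of a chain is finite, because every member is bounded below by
  \<open>- p (- x)\<close> at \<open>x\<close>. It is subadditive, because any two members of the chain can be replaced by
  the smaller one.
\<close>

lemma sublinear_chain_bound:
  assumes "C \<noteq> {}" and sub: "\<And>q. q \<in> C \<Longrightarrow> sublinear q \<and> q \<le> p"
    and chain: "\<And>q r. q \<in> C \<Longrightarrow> r \<in> C \<Longrightarrow> q \<le> r \<or> r \<le> q"
  shows "\<exists>h. sublinear h \<and> (\<forall>q\<in>C. h \<le> q)"
proof -
  define h where "h x = (INF q\<in>C. q x)" for x
  have "- p (- x) \<le> q x" if "q \<in> C" for q x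
  proof -
    have "q (- x) \<le> p (- x)" using sub[OF that] by (simp add: le_fun_def)
    then show ?thesis using sublinear_minus[of q x] sub[OF that] by linarith
  qed
  then have "bdd_below ((\<lambda>q. q x) ` C)" for x
    by (intro bdd_belowI2[of _ "- p (- x)"])
  then have h_le: "h x \<le> q x" if "q \<in> C" for q x
    unfolding h_def using that by (intro cINF_lower)
  have h_ge: "b \<le> h x" if "\<And>q. q \<in> C \<Longrightarrow> b \<le> q x" for b x
    unfolding h_def using that \<open>C \<noteq> {}\<close> by (intro cINF_greatest)
  have "sublinear h"
  proof (rule sublinearI)
    fix x y
    have "h (x + y) - q x \<le> r y" if q: "q \<in> C" and r: "r \<in> C" for q r
    proof -
      from chain[OF q r] obtain s where s: "s \<in> C" "s \<le> q" "s \<le> r" using q r by blast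
      have "h (x + y) \<le> s x + s y"
        using h_le[OF s(1), of "x + y"] sublinear_add[of s x y] sub[OF s(1)] by linarith
      moreover have "s x \<le> q x" "s y \<le> r y" using s by (auto simp: le_fun_def)
      ultimately show ?thesis by linarith
    qed
    then have "h (x + y) - q x \<le> h y" if "q \<in> C" for q
      using that by (intro h_ge)
    then have "h (x + y) - h y \<le> h x"
      by (intro h_ge) (simp add: algebra_simps)
    then show "h (x + y) \<le> h x + h y" by simp
  next
    fix a :: real and x assume a: "a > 0"
    have "h (a *\<^sub>R x) / a \<le> h x"
    proof (rule h_ge)
      fix q assume "q \<in> C"
      then show "h (a *\<^sub>R x) / a \<le> q x"
        using h_le[of q "a *\<^sub>R x"] sub[of q] a by (simp add: sublinear_scaleR_pos field_simps)
    qed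
    then show "h (a *\<^sub>R x) \<le> a * h x" using a by (simp add: field_simps)
  qed
  then show ?thesis using h_le by (auto simp: le_fun_def)
qed

lemma ex_linear_below_sublinear:
  fixes p :: "'a::real_vector \<Rightarrow> real"
  assumes p: "sublinear p"
  shows "\<exists>f. linear f \<and> f \<le> p"
proof -
  define A where "A = {q. sublinear q \<and> q \<le> p}"
  \<comment> \<open>The order is reversed: a maximal element for \<open>P\<close> is a minimal sublinear functional.\<close>
  define P where "P = (\<lambda>q r :: 'a \<Rightarrow> real. r \<le> q)"
  have "\<exists>m\<in>A. \<forall>q\<in>A. P m q \<longrightarrow> q = m"
  proof (rule predicate_Zorn)
    show "partial_order_on A (relation_of P A)"
      unfolding P_def by (rule partial_order_on_relation_ofI) auto
    fix C assume "C \<in> Chains (relation_of P A)"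
    then have C: "\<And>q. q \<in> C \<Longrightarrow> sublinear q \<and> q \<le> p"
      "\<And>q r. q \<in> C \<Longrightarrow> r \<in> C \<Longrightarrow> q \<le> r \<or> r \<le> q"
      unfolding Chains_def relation_of_def A_def P_def by auto
    show "\<exists>u\<in>A. \<forall>q\<in>C. P q u"
    proof (cases "C = {}")
      case True
      then show ?thesis using p by (auto simp: A_def)
    next
      case False
      from sublinear_chain_bound[OF False C] obtain h where h: "sublinear h" "\<And>q. q \<in> C \<Longrightarrow> h \<le> q"
        by blast
      from False obtain q where "q \<in> C" by blast
      then have "h \<le> p" using h(2) C(1) by (meson order_trans)
      then show ?thesis using h by (auto simp: A_def P_def)
    qed
  qed
  then obtain m where m: "sublinear m" "m \<le> p"
    and min: "\<And>q. sublinear q \<Longrightarrow> q \<le> p \<Longrightarrow> q \<le> m \<Longrightarrow> q = m"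
    by (auto simp: A_def P_def)
  have "linear m"
    using m(1) by (rule minimal_sublinear_imp_linear) (use min m(2) in \<open>meson order_trans\<close>)
  with m(2) show ?thesis by blast
qed

text \<open>
  Starting from \<open>lower_along p u\<close> instead of \<open>p\<close> forces \<open>f (- u) \<le> - p u\<close>, which is equality at
  \<open>u\<close>.
\<close>

theorem hahn_banach_sublinear:
  assumes p: "sublinear p"
  shows "\<exists>f. linear f \<and> (\<forall>x. f x \<le> p x) \<and> f u = p u"
proof -
  obtain f where f: "linear f" "\<And>x. f x \<le> lower_along p u x"
    using ex_linear_below_sublinear[OF sublinear_lower_along[OF p]] by (auto simp: le_fun_def)
  have le: "f x \<le> p x" for x
    using f(2)[of x] lower_along_le_self[OF p, of u x] by linarith
  have "- f u \<le> - p u"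
    using f(2)[of "- u"] lower_along_minus[OF p, of u] linear_neg[OF f(1), of u] by linarith
  then show ?thesis using f(1) le le[of u] by (intro exI[of _ f]) auto
qed

section \<open>Functionals measuring the distance to a subspace\<close>

lemma infdist_subspace_sublinear:
  fixes M :: "'a::real_normed_vector set"
  assumes M: "subspace M"
  shows "sublinear (\<lambda>x. infdist x M)"
proof (rule sublinearI)
  have ne: "M \<noteq> {}" using M subspace_0 by blast
  have ge: "b \<le> infdist x M" if "\<And>m. m \<in> M \<Longrightarrow> b \<le> dist x m" for b x
    unfolding infdist_notempty[OF ne] using ne that by (intro cINF_greatest)
  show "infdist (x + y) M \<le> infdist x M + infdist y M" for x y
  proof -
    have "infdist (x + y) M \<le> dist x m + dist y n" if "m \<in> M" "n \<in> M" for m n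
      using infdist_le[OF subspace_add[OF M that], of "x + y"] dist_triangle_add[of x y m n]
      by linarith
    then have "infdist (x + y) M - dist x m \<le> infdist y M" if "m \<in> M" for m
      using that by (intro ge) (simp add: algebra_simps)
    then have "infdist (x + y) M - infdist y M \<le> infdist x M"
      by (intro ge) (simp add: algebra_simps)
    then show ?thesis by simp
  qed
  show "infdist (a *\<^sub>R x) M \<le> a * infdist x M" if a: "a > 0" for a x
  proof -
    have "infdist (a *\<^sub>R x) M / a \<le> infdist x M"
    proof (rule ge)
      fix m assume "m \<in> M"
      then have "infdist (a *\<^sub>R x) M \<le> a * dist x m"
        using infdist_le[OF subspace_mul[OF M, of m a], of "a *\<^sub>R x"] a
        by (simp add: dist_norm flip: scaleR_diff_right)
      then show "infdist (a *\<^sub>R x) M / a \<le> dist x m" using a by (simp add: field_simps)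
    qed
    then show ?thesis using a by (simp add: field_simps)
  qed
qed

text \<open>
  The distance to \<open>M\<close> is sublinear, vanishes on \<open>M\<close> and is at most the norm, so Hahn-Banach
  applied to it gives all three properties at once.
\<close>

lemma ex_functional_infdist:
  fixes M :: "'a::real_normed_vector set" and u :: 'a
  assumes M: "subspace M"
  shows "\<exists>f :: 'a \<Rightarrow>\<^sub>L real. (\<forall>x\<in>M. f x = 0) \<and> f u = infdist u M \<and> (\<forall>x. \<bar>f x\<bar> \<le> norm x)"
proof -
  obtain f where f: "linear f" "\<And>x. f x \<le> infdist x M" "f u = infdist u M"
    using hahn_banach_sublinear[OF infdist_subspace_sublinear[OF M]] by blast
  have neg: "f (- x) = - f x" for x using linear_neg[OF f(1)] .
  have dist_le: "infdist x M \<le> norm x" for x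
    using infdist_le[OF subspace_0[OF M], of x] by simp
  have bound: "\<bar>f x\<bar> \<le> norm x" for x
    using f(2)[of x] f(2)[of "- x"] neg[of x] dist_le[of x] dist_le[of "- x"] by simp
  have "f x = 0" if "x \<in> M" for x
    using f(2)[of x] f(2)[of "- x"] neg[of x] that subspace_neg[OF M that] by simp
  moreover have "bounded_linear f"
    using f(1) bound by (auto simp: linear_add linear_cmul intro!: bounded_linear_intro[of f 1])
  ultimately show ?thesis
    using f(3) bound by (intro exI[of _ "Blinfun f"]) (simp add: bounded_linear_Blinfun_apply)
qed

lemma ex_norming_functional:
  fixes u :: "'a::real_normed_vector"
  shows "\<exists>f :: 'a \<Rightarrow>\<^sub>L real. f u = norm u \<and> (\<forall>x. \<bar>f x\<bar> \<le> norm x)"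
  using ex_functional_infdist[of "{0}" u] by (auto simp: infdist_notempty)

text \<open>
  If \<open>F d\<close> vanishes at \<open>x\<close>, then \<open>norm d = F d (d - x) \<le> dist d x\<close>; for \<open>d\<close> near \<open>x\<close> this makes the
  norm of \<open>x\<close> small.
\<close>

lemma norming_functionals_separate_closure:
  fixes D :: "'a::real_normed_vector set" and F :: "'a \<Rightarrow> 'a \<Rightarrow>\<^sub>L real"
  assumes F: "\<And>d. F d d = norm d" "\<And>d x. \<bar>F d x\<bar> \<le> norm x"
    and x: "x \<in> closure D" and zero: "\<And>d. d \<in> D \<Longrightarrow> F d x = 0"
  shows "x = 0"
proof (rule ccontr)
  assume "x \<noteq> 0"
  then obtain d where d: "d \<in> D" "dist d x < norm x / 2"
    using x unfolding closure_approachable by (meson half_gt_zero zero_less_norm_iff)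
  have "norm d = F d (d - x)"
    using F(1)[of d] zero[OF d(1)] by (simp add: blinfun.diff_right)
  also have "\<dots> \<le> dist d x"
    using F(2)[of d "d - x"] by (simp add: dist_norm)
  finally show False
    using d(2) norm_triangle_ineq2[of x d] by (simp add: dist_norm norm_minus_commute)
qed

section \<open>Weak sequential compactness in reflexive spaces\<close>

text \<open>
  Reflexivity turns a bounded linear functional on the dual space into a point. The functional
  used here lies below \<open>limsup (\<lambda>n. f (v n))\<close> for all \<open>f\<close> and equals it at \<open>f0\<close>; the conclusion
  expresses these two facts through eventual upper bounds.
\<close>

lemma ex_generalized_weak_limit:
  fixes v :: "nat \<Rightarrow> 'h::real_normed_vector" and f0 :: "'h \<Rightarrow>\<^sub>L real"
  assumes refl: "reflexive_space TYPE('h)" and bdd: "bounded (range v)"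
  shows "\<exists>u. (\<forall>f :: 'h \<Rightarrow>\<^sub>L real. \<forall>b. (\<forall>\<^sub>F n in sequentially. f (v n) \<le> b) \<longrightarrow> f u \<le> b) \<and>
             (\<forall>b > f0 u. \<forall>\<^sub>F n in sequentially. f0 (v n) \<le> b)"
proof -
  obtain B where B: "B > 0" "\<And>n. norm (v n) \<le> B"
    using bdd by (auto simp: bounded_pos)
  \<comment> \<open>\<open>p f\<close> is the upper limit of \<open>f (v n)\<close>, as the infimum of the eventual upper bounds.\<close>
  define U where "U f = {b. \<forall>\<^sub>F n in sequentially. blinfun_apply f (v n) \<le> b}" for f :: "'h \<Rightarrow>\<^sub>L real"
  define p where "p f = Inf (U f)" for f
  have abs_le: "\<bar>blinfun_apply f (v n)\<bar> \<le> norm f * B" for f n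
    using norm_blinfun[of f "v n"] mult_left_mono[OF B(2)[of n] norm_ge_zero[of f]] by simp
  have bound_in_U: "norm f * B \<in> U f" for f
    using abs_le[of f] by (auto simp: U_def abs_le_iff)
  have U_bound: "- (norm f * B) \<le> b" if b: "b \<in> U f" for f b
  proof -
    obtain n where "f (v n) \<le> b" using b by (auto simp: U_def eventually_sequentially)
    then show ?thesis using abs_le[of f n] by linarith
  qed
  have "bdd_below (U f)" for f
    using U_bound by (rule bdd_belowI)
  then have p_le: "p f \<le> b" if "b \<in> U f" for f b
    unfolding p_def using that by (intro cInf_lower)
  have p_ge: "b \<le> p f" if "\<And>c. c \<in> U f \<Longrightarrow> b \<le> c" for f b
    unfolding p_def using that bound_in_U by (intro cInf_greatest) auto
  have "sublinear p"
  proof (rule sublinearI)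
    fix f g
    have "b + c \<in> U (f + g)" if "b \<in> U f" "c \<in> U g" for b c
      using that unfolding U_def mem_Collect_eq
      by eventually_elim (simp add: blinfun.add_left add_mono)
    then have "p (f + g) - b \<le> c" if "b \<in> U f" "c \<in> U g" for b c
      using p_le[of "b + c" "f + g"] that by (simp add: algebra_simps)
    then have "p (f + g) - b \<le> p g" if "b \<in> U f" for b
      using that by (intro p_ge)
    then have "p (f + g) - p g \<le> p f"
      by (intro p_ge) (simp add: algebra_simps)
    then show "p (f + g) \<le> p f + p g" by simp
  next
    fix a :: real and f assume a: "a > 0"
    have "a * b \<in> U (a *\<^sub>R f)" if "b \<in> U f" for b
      using that a by (simp add: U_def blinfun.scaleR_left)
    then have "p (a *\<^sub>R f) / a \<le> p f"
      using a by (intro p_ge) (simp add: p_le field_simps)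
    then show "p (a *\<^sub>R f) \<le> a * p f" using a by (simp add: field_simps)
  qed
  from hahn_banach_sublinear[OF this] obtain \<phi>
    where \<phi>: "linear \<phi>" "\<And>f. \<phi> f \<le> p f" "\<phi> f0 = p f0" by blast
  have "\<bar>\<phi> f\<bar> \<le> norm f * B" for f
    using \<phi>(2)[of f] \<phi>(2)[of "- f"] p_le[OF bound_in_U[of f]] p_le[OF bound_in_U[of "- f"]]
      linear_neg[OF \<phi>(1), of f] by simp
  then have "bounded_linear \<phi>"
    using \<phi>(1) by (auto simp: linear_add linear_cmul intro!: bounded_linear_intro[of \<phi> B])
  then obtain u where u: "\<And>f. \<phi> f = blinfun_apply f u"
    using refl unfolding reflexive_space_def by (metis bounded_linear_Blinfun_apply)
  have "f u \<le> b" if "\<forall>\<^sub>F n in sequentially. f (v n) \<le> b" for f :: "'h \<Rightarrow>\<^sub>L real" and b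
    using \<phi>(2)[of f] p_le[of b f] that u[of f] by (simp add: U_def)
  moreover have "\<forall>\<^sub>F n in sequentially. f0 (v n) \<le> b" if "b > f0 u" for b
  proof -
    have "p f0 < b" using that u[of f0] \<phi>(3) by simp
    then obtain c where c: "c \<in> U f0" "c < b" using p_ge[of f0 b] by (meson not_le)
    then have "\<forall>\<^sub>F n in sequentially. f0 (v n) \<le> c" by (simp add: U_def)
    then show ?thesis by (rule eventually_mono) (use c(2) in simp)
  qed
  ultimately show ?thesis by blast
qed

text \<open>
  The finite combinations of elements of \<open>A\<close> with rational coefficients are closed under addition
  and rational scaling; passing to the closure gives real scaling.
\<close>

lemma ex_countable_dense_subspace:
  fixes A :: "'a::real_normed_vector set"
  assumes "countable A"
  shows "\<exists>D. countable D \<and> A \<subseteq> D \<and> subspace (closure D)"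
proof -
  define comb :: "(rat \<times> 'a) list \<Rightarrow> 'a"
    where "comb xs = (\<Sum>(q, a)\<leftarrow>xs. of_rat q *\<^sub>R a)" for xs
  define D where "D = comb ` lists (UNIV \<times> A)"
  have "countable D"
    unfolding D_def using assms by (intro countable_image countable_lists) auto
  moreover have "A \<subseteq> D"
  proof
    fix a assume "a \<in> A"
    then have "comb [(1, a)] \<in> D" unfolding D_def by (intro imageI) auto
    then show "a \<in> D" by (simp add: comb_def)
  qed
  moreover have "subspace (closure D)"
  proof (rule subspaceI)
    have "comb [] \<in> D" unfolding D_def by (intro imageI) auto
    then show "0 \<in> closure D" using closure_subset by (auto simp: comb_def)
    have add: "x + y \<in> D" if "x \<in> D" "y \<in> D" for x y
    proof -
      from that obtain xs ys where "xs \<in> lists (UNIV \<times> A)" "ys \<in> lists (UNIV \<times> A)"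
        "x = comb xs" "y = comb ys" by (auto simp: D_def)
      then have "x + y = comb (xs @ ys)" "xs @ ys \<in> lists (UNIV \<times> A)" by (auto simp: comb_def)
      then show ?thesis by (auto simp: D_def)
    qed
    have scale: "of_rat r *\<^sub>R x \<in> D" if "x \<in> D" for r x
    proof -
      from that obtain xs where xs: "xs \<in> lists (UNIV \<times> A)" "x = comb xs" by (auto simp: D_def)
      have "of_rat r *\<^sub>R comb xs = comb (map (\<lambda>(q, a). (r * q, a)) xs)"
        by (induction xs) (auto simp: comb_def of_rat_mult scaleR_add_right)
      moreover have "map (\<lambda>(q, a). (r * q, a)) xs \<in> lists (UNIV \<times> A)" using xs(1) by auto
      ultimately show ?thesis using xs(2) by (auto simp: D_def)
    qed
    show "x + y \<in> closure D" if xy: "x \<in> closure D" "y \<in> closure D" for x y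
    proof -
      obtain X Y where "\<forall>n. X n \<in> D" "X \<longlonglongrightarrow> x" "\<forall>n. Y n \<in> D" "Y \<longlonglongrightarrow> y"
        using xy unfolding closure_sequential by blast
      then show ?thesis
        unfolding closure_sequential by (intro exI[of _ "\<lambda>n. X n + Y n"]) (auto intro: add tendsto_add)
    qed
    show "a *\<^sub>R x \<in> closure D" if x: "x \<in> closure D" for a x
    proof -
      obtain X where X: "\<And>n. X n \<in> D" "X \<longlonglongrightarrow> x"
        using x by (auto simp: closure_sequential)
      have "a \<in> closure \<rat>" by (simp add: Rats_closure_real)
      then obtain R where R: "\<And>n. R n \<in> \<rat>" "R \<longlonglongrightarrow> a"
        by (auto simp: closure_sequential)
      have "R n *\<^sub>R X n \<in> D" for n using R(1)[of n] X(1)[of n] scale by (metis Rats_cases)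
      then show ?thesis
        unfolding closure_sequential using R(2) X(2)
        by (intro exI[of _ "\<lambda>n. R n *\<^sub>R X n"]) (auto intro: tendsto_scaleR)
    qed
  qed
  ultimately show ?thesis by blast
qed

text \<open>
  The diagonal subsequence \<open>v\<close> makes countably many norming functionals converge. Every point
  \<open>u\<close> with \<open>f u \<le> limsup (\<lambda>n. f (v n))\<close> for all \<open>f\<close> takes prescribed values under these
  functionals and lies in the closed span of the sequence, where they separate points. Hence the
  point attaining the upper limit of one functional attains it for all of them.
\<close>

theorem reflexive_bounded_imp_weakly_convergent_subsequence:
  fixes X :: "nat \<Rightarrow> 'h::real_normed_vector"
  assumes refl: "reflexive_space TYPE('h)" and bdd: "bounded (range X)"
  shows "\<exists>r u. strict_mono (r :: nat \<Rightarrow> nat) \<and> weakly_converges (X \<circ> r) u"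
proof -
  obtain D where D: "countable D" "range X \<subseteq> D" "subspace (closure D)"
    using ex_countable_dense_subspace[of "range X"] by auto
  obtain F :: "'h \<Rightarrow> 'h \<Rightarrow>\<^sub>L real" where F: "\<And>d. F d d = norm d" "\<And>d x. \<bar>F d x\<bar> \<le> norm x"
    using ex_norming_functional by metis
  obtain B where B: "\<And>n. norm (X n) \<le> B"
    using bdd by (auto simp: bounded_iff)
  obtain r :: "nat \<Rightarrow> nat" where r: "strict_mono r"
    and conv: "\<And>d. d \<in> D \<Longrightarrow> \<exists>l. (\<lambda>n. F d (X (r n))) \<longlonglongrightarrow> l"
  proof (rule function_convergent_subsequence[OF D(1), of "\<lambda>n d. F d (X n)" B])
    show "norm (F d (X n)) \<le> B" for n d
      using F(2)[of d "X n"] B[of n] by simp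
  qed auto
  define v where "v = X \<circ> r"
  have v: "bounded (range v)"
    using bdd unfolding v_def by (rule bounded_subset) auto
  define weak_cluster where "weak_cluster u \<longleftrightarrow>
    (\<forall>f :: 'h \<Rightarrow>\<^sub>L real. \<forall>b. (\<forall>\<^sub>F n in sequentially. f (v n) \<le> b) \<longrightarrow> f u \<le> b)" for u
  \<comment> \<open>The functional that measures the distance to \<open>closure D\<close> vanishes along the sequence.\<close>
  have in_closure: "u \<in> closure D" if u: "weak_cluster u" for u
  proof -
    obtain f :: "'h \<Rightarrow>\<^sub>L real"
      where f: "\<And>x. x \<in> closure D \<Longrightarrow> f x = 0" "f u = infdist u (closure D)"
      using ex_functional_infdist[OF D(3)] by blast
    have "f (v n) = 0" for n
      using f(1)[of "v n"] D(2) closure_subset[of D] by (auto simp: v_def)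
    then have "f u \<le> 0" using u by (auto simp: weak_cluster_def)
    then have "infdist u (closure D) = 0" using f(2) infdist_nonneg[of u "closure D"] by simp
    moreover have "closure D \<noteq> {}" using subspace_0[OF D(3)] by auto
    ultimately show ?thesis by (simp add: in_closed_iff_infdist_zero)
  qed
  have lim: "f u = l" if u: "weak_cluster u" and l: "(\<lambda>n. f (v n)) \<longlonglongrightarrow> l"
    for u l and f :: "'h \<Rightarrow>\<^sub>L real"
  proof -
    have le: "g u \<le> k" if g: "(\<lambda>n. g (v n)) \<longlonglongrightarrow> k" for k and g :: "'h \<Rightarrow>\<^sub>L real"
    proof (rule dense_ge)
      fix b assume "k < b"
      then have "\<forall>\<^sub>F n in sequentially. g (v n) \<le> b"
        by (intro eventually_mono[OF order_tendstoD(2)[OF g]]) auto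
      then show "g u \<le> b" using u by (auto simp: weak_cluster_def)
    qed
    have "(- f) u \<le> - l"
      using l by (intro le) (auto simp: blinfun.minus_left intro: tendsto_minus)
    then show ?thesis using le[OF l] by (simp add: blinfun.minus_left)
  qed
  have unique: "u = u'" if u: "weak_cluster u" "weak_cluster u'" for u u'
  proof -
    have "u - u' \<in> closure D"
      using in_closure u D(3) by (intro subspace_diff)
    moreover have "F d (u - u') = 0" if d: "d \<in> D" for d
    proof -
      obtain l where "(\<lambda>n. F d (v n)) \<longlonglongrightarrow> l" using conv[OF d] by (auto simp: v_def)
      from lim[OF u(1) this] lim[OF u(2) this] show ?thesis by (simp add: blinfun.diff_right)
    qed
    ultimately have "u - u' = 0" using norming_functionals_separate_closure[OF F] by blast
    then show ?thesis by simp
  qed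
  have ex: "\<exists>u. weak_cluster u \<and> (\<forall>b > f u. \<forall>\<^sub>F n in sequentially. f (v n) \<le> b)"
    for f :: "'h \<Rightarrow>\<^sub>L real"
    using ex_generalized_weak_limit[OF refl v, of f] by (simp add: weak_cluster_def)
  obtain u where u: "weak_cluster u" using ex by blast
  have upper: "\<forall>\<^sub>F n in sequentially. f (v n) < b" if b: "b > f u" for f :: "'h \<Rightarrow>\<^sub>L real" and b
  proof -
    from dense[OF b] obtain b' where b': "f u < b'" "b' < b" by blast
    obtain w where w: "weak_cluster w" "\<And>b. b > f w \<Longrightarrow> \<forall>\<^sub>F n in sequentially. f (v n) \<le> b"
      using ex[of f] by blast
    then have "\<forall>\<^sub>F n in sequentially. f (v n) \<le> b'"
      using unique[OF w(1) u] b'(1) by simp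
    then show ?thesis by (rule eventually_mono) (use b'(2) in simp)
  qed
  \<comment> \<open>The lower bound is the upper bound for \<open>- f\<close>.\<close>
  have "(\<lambda>n. f (v n)) \<longlonglongrightarrow> f u" for f :: "'h \<Rightarrow>\<^sub>L real"
  proof (rule order_tendstoI)
    show "\<forall>\<^sub>F n in sequentially. b < f (v n)" if "b < f u" for b
      using upper[of "- f" "- b"] that by (simp add: blinfun.minus_left)
  qed (rule upper)
  then have "weakly_converges (X \<circ> r) u" by (simp add: weakly_converges_def v_def)
  with r show ?thesis by blast
qed

section \<open>Attainment of the constrained infimum\<close>

lemma constrained_inf_le: "constrained_inf J G (G u) \<le> ereal (J u)"
  unfolding constrained_inf_def by (rule INF_lower) simp

theorem proposition1p2:
  fixes rep :: "'h::banach \<Rightarrow> real^'N::finite \<Rightarrow> real^'m::finite"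
    and j :: "real^'N \<Rightarrow> real^'m \<Rightarrow> real \<Rightarrow> real"
    and g :: "real^'m \<Rightarrow> real"
    and J G :: "'h \<Rightarrow> real"
    and c :: real
    and us :: "nat \<Rightarrow> 'h"
  assumes reflexive: "reflexive_space TYPE('h)"
    and function_space: "function_space_rep rep"
    and gradients: "\<And>u. \<exists>D. has_weak_gradient (rep u) D"
    and J_form: "\<And>u. has_bochner_integral lebesgue
                   (\<lambda>x. j x (rep u x) (norm (weak_gradient (rep u) x))) (J u)"
    and G_form: "\<And>u. has_bochner_integral lebesgue (\<lambda>x. g (rep u x)) (G u)"
    and decreasing: "strict_antimono_on UNIV (constrained_inf J G)"
    and c_pos: "c > 0"
    and admissible: "\<And>n. G (us n) = c"
    and minimizing: "(\<lambda>n. ereal (J (us n))) \<longlonglongrightarrow> constrained_inf J G c"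
    and bounded_seq: "bounded (range us)"
    and weak_limits: "\<And>r u. strict_mono (r :: nat \<Rightarrow> nat) \<Longrightarrow> weakly_converges (us \<circ> r) u \<Longrightarrow>
                   ereal (J u) \<le> liminf (\<lambda>n. ereal (J (us (r n)))) \<and> G u \<le> c"
  shows "\<exists>w. G w = c \<and> ereal (J w) = constrained_inf J G c"
proof -
  obtain r :: "nat \<Rightarrow> nat" and u where r: "strict_mono r" and u: "weakly_converges (us \<circ> r) u"
    using reflexive_bounded_imp_weakly_convergent_subsequence[OF reflexive bounded_seq] by blast
  have "((\<lambda>n. ereal (J (us n))) \<circ> r) \<longlonglongrightarrow> constrained_inf J G c"
    using minimizing r by (rule LIMSEQ_subseq_LIMSEQ)
  then have "liminf (\<lambda>n. ereal (J (us (r n)))) = constrained_inf J G c"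
    by (intro lim_imp_Liminf) (auto simp: o_def)
  then have J_le: "ereal (J u) \<le> constrained_inf J G c" and G_le: "G u \<le> c"
    using weak_limits[OF r u] by auto
  have "G u = c"
  proof (rule ccontr)
    assume "G u \<noteq> c"
    then have "constrained_inf J G c < constrained_inf J G (G u)"
      using G_le decreasing by (auto simp: monotone_on_def)
    also have "\<dots> \<le> ereal (J u)" by (rule constrained_inf_le)
    finally show False using J_le by simp
  qed
  then show ?thesis
    using J_le constrained_inf_le[of J G u] by (intro exI[of _ u]) auto
qed

end
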